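(* Let $\pi\in\mathcal{P}^n$ be a profile and let $\succ_0\in\mathcal{P}$ be a preference around which $\pi$ exhibits Flexible Consensus. Then $Best(\succ_0)$ is a weak Condorcet winner of $\pi$. Moreover, if $n$ is odd, then $\succ_0$ coincides with the majority relation $M_\pi$ (that is, for all distinct alternatives $a,b$: $a\succ_0 b$ if and only if $a\,M_\pi\,b$), and $\succ_0$ is the unique preference in $\mathcal{P}$ around which $\pi$ exhibits Flexible Consensus.
   Context: Let $A$ be a set of $K\ge 3$ alternatives and let $\mathcal{P}$ be the set of all $K!$ strict total orders on $A$, called preferences. A profile $\pi=(\succ_1,\dots,\succ_n)\in\mathcal{P}^n$ is a list of $n$ preferences, one per voter. The frequency of $\succ\in\mathcal{P}$ is $\mu_\pi(\succ)=|\{i:\succ_i=\succ\}|$. The inversion distance $d(\succ,\succ')$ is the number of two-element subsets $\{a,b\}\subseteq A$ that are ranked differently by $\succ$ and $\succ'$. $\pi$ exhibits Flexible Consensus around $\succ_0$ if for all $\succ',\succ\in\mathcal{P}$: $\mu_\pi(\succ')>\mu_\pi(\succ)$ implies $d(\succ',\succ_0)\le d(\succ,\succ_0)$. Majority relation: for distinct alternatives $a,b$, $a\,M_\pi\,b$ means that the number of voters $i$ with $a\succ_i b$ is at least the number of voters $i$ with $b\succ_i a$. A weak Condorcet winner of $\pi$ is an alternative $a$ such that $a\,M_\pi\,b$ for every alternative $b\ne a$. $Best(\succ_0)$ denotes the alternative ranked first by $\succ_0$. *)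

theory Defs
  imports Main
begin

text \<open>
  A preference is a strict total order; \<open>(a, b) \<in> r\<close> means that \<open>a\<close> is strictly
  preferred to \<open>b\<close>. The inclusion in \<open>A \<times> A\<close> is needed because
  \<open>strict_linear_order_on\<close> does not confine the field of \<open>r\<close> to \<open>A\<close>.
\<close>

definition preferences :: "'a set \<Rightarrow> 'a rel set" where
  "preferences A = {r. r \<subseteq> A \<times> A \<and> strict_linear_order_on A r}"

definition profiles :: "'a set \<Rightarrow> nat \<Rightarrow> 'a rel list set" where
  "profiles A n = {\<pi>. length \<pi> = n \<and> set \<pi> \<subseteq> preferences A}"

definition frequency :: "'a rel list \<Rightarrow> 'a rel \<Rightarrow> nat" where
  "frequency \<pi> r = card {i. i < length \<pi> \<and> \<pi> ! i = r}"

definition inversion_distance :: "'a set \<Rightarrow> 'a rel \<Rightarrow> 'a rel \<Rightarrow> nat" where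
  "inversion_distance A r s =
     card {{a, b} | a b. a \<in> A \<and> b \<in> A \<and> a \<noteq> b \<and> ((a, b) \<in> r) \<noteq> ((a, b) \<in> s)}"

definition flexible_consensus :: "'a set \<Rightarrow> 'a rel list \<Rightarrow> 'a rel \<Rightarrow> bool" where
  "flexible_consensus A \<pi> r0 \<longleftrightarrow>
     (\<forall>s \<in> preferences A. \<forall>r \<in> preferences A.
        frequency \<pi> s > frequency \<pi> r \<longrightarrow>
        inversion_distance A s r0 \<le> inversion_distance A r r0)"

text \<open>The majority relation is only used for distinct alternatives.\<close>

definition majority :: "'a rel list \<Rightarrow> 'a \<Rightarrow> 'a \<Rightarrow> bool" where
  "majority \<pi> a b \<longleftrightarrow>
     card {i. i < length \<pi> \<and> (a, b) \<in> \<pi> ! i} \<ge> card {i. i < length \<pi> \<and> (b, a) \<in> \<pi> ! i}"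

definition weak_condorcet_winner :: "'a set \<Rightarrow> 'a rel list \<Rightarrow> 'a \<Rightarrow> bool" where
  "weak_condorcet_winner A \<pi> a \<longleftrightarrow> a \<in> A \<and> (\<forall>b \<in> A. b \<noteq> a \<longrightarrow> majority \<pi> a b)"

definition best :: "'a set \<Rightarrow> 'a rel \<Rightarrow> 'a" where
  "best A r = (THE a. a \<in> A \<and> (\<forall>b \<in> A. b \<noteq> a \<longrightarrow> (a, b) \<in> r))"

end

theory Submission
  imports Defs "HOL-Combinatorics.Transposition"
begin

text \<open>
  Let \<open>r0\<close> rank \<open>a\<close> above \<open>b\<close>. Exchanging \<open>a\<close> and \<open>b\<close> is a bijection from the preferences ranking
  \<open>a\<close> above \<open>b\<close> onto those ranking \<open>b\<close> above \<open>a\<close>, and it strictly increases the inversion distance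
  to \<open>r0\<close>. Hence Flexible Consensus makes it not increase frequencies, and summing over all
  preferences that rank \<open>a\<close> above \<open>b\<close> gives a weak majority for \<open>a\<close>. For odd \<open>n\<close> there are no ties,
  so the majority relation is antisymmetric and determines \<open>r0\<close>.
\<close>

lemma preferencesD:
  assumes "r \<in> preferences A"
  shows "r \<subseteq> A \<times> A" "trans r" "irrefl r" "total_on A r"
  using assms by (auto simp: preferences_def strict_linear_order_on_def)

lemma finite_preferences: "finite A \<Longrightarrow> finite (preferences A)"
  by (rule finite_subset[of _ "Pow (A \<times> A)"]) (auto simp: preferences_def)

lemma preference_asym:
  assumes "r \<in> preferences A" "(x, y) \<in> r"
  shows "(y, x) \<notin> r"
  using transD[OF preferencesD(2)[OF assms(1)] assms(2)] irreflD[OF preferencesD(3)[OF assms(1)]]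
  by blast

lemma preference_not_iff:
  assumes "r \<in> preferences A" "x \<in> A" "y \<in> A" "x \<noteq> y"
  shows "(x, y) \<notin> r \<longleftrightarrow> (y, x) \<in> r"
  using preference_asym[OF assms(1)] preferencesD(4)[OF assms(1)] assms(2-)
  unfolding total_on_def by blast

text \<open>By totality and asymmetry, a pair ranked differently has exactly one orientation in
  \<open>r\<close>, and that orientation is missing from \<open>s\<close>. Counting ordered pairs
  makes set algebra available for comparing distances.\<close>

lemma inversion_distance_eq_card_diff:
  assumes s: "s \<in> preferences A" and r: "r \<in> preferences A"
  shows "inversion_distance A s r = card (r - s)"
proof -
  have "{{x, y} | x y. x \<in> A \<and> y \<in> A \<and> x \<noteq> y \<and> ((x, y) \<in> s) \<noteq> ((x, y) \<in> r)}
      = (\<lambda>(x, y). {x, y}) ` (r - s)" (is "?D = ?I")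
  proof
    show "?D \<subseteq> ?I"
    proof
      fix p assume "p \<in> ?D"
      then obtain x y where p: "p = {x, y}"
        and xy: "x \<in> A" "y \<in> A" "x \<noteq> y" "((x, y) \<in> s) \<noteq> ((x, y) \<in> r)"
        by blast
      have "(x, y) \<in> r - s \<or> (y, x) \<in> r - s"
        using xy preference_not_iff[OF s] preference_not_iff[OF r] by blast
      then show "p \<in> ?I"
        using p by (force simp: insert_commute)
    qed
    show "?I \<subseteq> ?D"
    proof
      fix p assume "p \<in> ?I"
      then obtain x y where p: "p = {x, y}" and xy: "(x, y) \<in> r" "(x, y) \<notin> s" by auto
      have "x \<in> A" "y \<in> A" "x \<noteq> y"
        using xy(1) preferencesD[OF r] by (auto dest: irreflD)
      then show "p \<in> ?D" using p xy by blast
    qed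
  qed
  moreover have "inj_on (\<lambda>(x, y). {x, y}) (r - s)"
    using preference_asym[OF r] by (auto simp: inj_on_def doubleton_eq_iff)
  ultimately show ?thesis
    by (simp add: inversion_distance_def card_image)
qed

text \<open>\<open>a\<close> and \<open>b\<close> trade places in the ranking. Taking a preimage
  suffices, since a transposition is its own inverse.\<close>

definition exchange :: "'a \<Rightarrow> 'a \<Rightarrow> 'a rel \<Rightarrow> 'a rel" where
  "exchange a b s = {(x, y). (transpose a b x, transpose a b y) \<in> s}"

lemma exchange_iff: "(x, y) \<in> exchange a b s \<longleftrightarrow> (transpose a b x, transpose a b y) \<in> s"
  by (simp add: exchange_def)

lemma exchange_exchange [simp]: "exchange a b (exchange a b s) = s"
  by (auto simp: exchange_def)

lemma exchange_in_preferences: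
  assumes s: "s \<in> preferences A" and "a \<in> A" "b \<in> A"
  shows "exchange a b s \<in> preferences A"
proof -
  have A: "transpose a b x \<in> A \<longleftrightarrow> x \<in> A" for x
    using assms(2,3) by (simp add: transpose_def)
  have "exchange a b s \<subseteq> A \<times> A"
    using preferencesD(1)[OF s] A by (auto simp: exchange_iff)
  moreover have "trans (exchange a b s)"
    using preferencesD(2)[OF s] by (auto simp: exchange_iff intro!: transI dest: transD)
  moreover have "irrefl (exchange a b s)"
    using preferencesD(3)[OF s] by (auto simp: exchange_iff irrefl_def)
  moreover have "total_on A (exchange a b s)"
    unfolding total_on_def exchange_iff
  proof (intro ballI impI)
    fix x y assume "x \<in> A" "y \<in> A" "x \<noteq> y"
    then have "transpose a b x \<in> A" "transpose a b y \<in> A" "transpose a b x \<noteq> transpose a b y"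
      using A by (auto simp: transpose_eq_iff)
    then show "(transpose a b x, transpose a b y) \<in> s \<or> (transpose a b y, transpose a b x) \<in> s"
      using preferencesD(4)[OF s] unfolding total_on_def by blast
  qed
  ultimately show ?thesis
    by (simp add: preferences_def strict_linear_order_on_def)
qed

text \<open>Pairs of \<open>r\<close> missing from both \<open>s\<close> and the exchanged order
  count equally on both sides. The transposition injects those missing only from \<open>s\<close>
  into those missing only from the exchanged order, and \<open>(a, b)\<close> is an extra pair of
  the latter kind.\<close>

lemma inversion_distance_exchange:
  assumes A: "finite A" and s: "s \<in> preferences A" and r: "r \<in> preferences A"
    and ab_s: "(a, b) \<in> s" and ab_r: "(a, b) \<in> r"
  shows "inversion_distance A s r < inversion_distance A (exchange a b s) r"
proof -
  let ?s' = "exchange a b s" and ?\<sigma> = "transpose a b"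
  have ab: "a \<in> A" "b \<in> A" "a \<noteq> b"
    using ab_r preferencesD[OF r] by (auto dest: irreflD)
  have fin: "finite r"
    using preferencesD(1)[OF r] A by (auto intro: finite_subset)
  \<comment> \<open>Only pairs containing \<open>a\<close> or \<open>b\<close> move. For
    \<open>x = b\<close> or \<open>y = a\<close>, transitivity of \<open>r\<close> through
    \<open>(a, b)\<close> yields the moved pair; \<open>x = a\<close> and \<open>y = b\<close> are
    impossible because \<open>s\<close> ranks \<open>a\<close> above \<open>b\<close>.\<close>
  have r_mem: "(?\<sigma> x, ?\<sigma> y) \<in> r"
    if xy: "(x, y) \<in> r" "(x, y) \<notin> s" "(?\<sigma> x, ?\<sigma> y) \<in> s" for x y
  proof -
    have mem: "x \<in> A" "y \<in> A" "x \<noteq> y"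
      using xy(1) preferencesD[OF r] by (auto dest: irreflD)
    have yx: "(y, x) \<in> s" using preference_not_iff[OF s mem] xy(2) by simp
    note tr = transD[OF preferencesD(2)[OF r]] and ts = transD[OF preferencesD(2)[OF s]]
    consider "x = a" | "x = b" | "y = a" "x \<noteq> b" | "y = b" "x \<noteq> a" | "x \<notin> {a, b}" "y \<notin> {a, b}"
      by blast
    then show ?thesis
    proof cases
      case 1
      have "y \<noteq> b" using 1 xy(2) ab_s by blast
      then have "(b, y) \<in> s" using 1 xy(3) mem by (simp add: transpose_def)
      moreover have "(y, b) \<in> s" using ts[OF yx] 1 ab_s by simp
      ultimately show ?thesis using preference_asym[OF s] by blast
    next
      case 2
      have "y \<noteq> a" using 2 xy(1) ab_r preference_asym[OF r] by blast
      then show ?thesis using 2 mem tr[OF ab_r] xy(1) by (simp add: transpose_def)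
    next
      case 3
      then show ?thesis using mem tr[OF _ ab_r] xy(1) by (simp add: transpose_def)
    next
      case 4
      then have "(x, a) \<in> s" using xy(3) mem by (simp add: transpose_def)
      moreover have "(a, x) \<in> s" using ts[OF ab_s] yx 4 by simp
      ultimately show ?thesis using preference_asym[OF s] by blast
    next
      case 5
      then show ?thesis using xy(1) by (simp add: transpose_def)
    qed
  qed
  have ba: "(a, b) \<notin> ?s'"
    using preference_asym[OF s ab_s] by (simp add: exchange_iff)
  \<comment> \<open>The transposition interchanges membership in \<open>s\<close> and in
    \<open>?s'\<close>. It cannot produce \<open>(a, b)\<close>, whose preimage
    \<open>(b, a)\<close> is not in \<open>r\<close>.\<close>
  have "map_prod ?\<sigma> ?\<sigma> ` ((r - s) \<inter> ?s') \<subseteq> (r - ?s') \<inter> s - {(a, b)}"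
    using r_mem preference_asym[OF r ab_r] by (auto simp: exchange_iff transpose_eq_iff)
  moreover have "inj (map_prod ?\<sigma> ?\<sigma>)"
    by (intro prod.inj_map) auto
  ultimately have "card ((r - s) \<inter> ?s') \<le> card ((r - ?s') \<inter> s - {(a, b)})"
    using fin by (intro card_inj_on_le[where f = "map_prod ?\<sigma> ?\<sigma>"]) (auto intro: inj_on_subset)
  \<comment> \<open>The unattained pair \<open>(a, b)\<close> belongs to this set, which makes the
    inequality strict.\<close>
  also have "\<dots> < card ((r - ?s') \<inter> s)"
    using fin ab_s ab_r ba by (intro card_Diff1_less) auto
  finally have less: "card ((r - s) \<inter> ?s') < card ((r - ?s') \<inter> s)" .
  \<comment> \<open>Both differences split into the part just compared and the common part
    \<open>r - s - ?s'\<close>.\<close>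
  have "card (r - s) = card ((r - s) \<inter> ?s') + card (r - s - ?s')"
    using fin by (subst card_Un_disjoint[symmetric]) (auto intro!: arg_cong[where f = card])
  also have "\<dots> < card ((r - ?s') \<inter> s) + card (r - s - ?s')"
    using less by simp
  also have "\<dots> = card (r - ?s')"
    using fin by (subst card_Un_disjoint[symmetric]) (auto intro!: arg_cong[where f = card])
  finally show ?thesis
    using inversion_distance_eq_card_diff[OF s r]
      inversion_distance_eq_card_diff[OF exchange_in_preferences[OF s ab(1,2)] r]
    by simp
qed

text \<open>Grouping voters by the preference they hold turns majority counts into sums of
  frequencies, the quantities that Flexible Consensus constrains.\<close>

lemma card_voters_eq_sum_frequency:
  assumes "finite A" "\<pi> \<in> profiles A n"
  shows "card {i. i < length \<pi> \<and> (a, b) \<in> \<pi> ! i}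
    = (\<Sum>s \<in> {s \<in> preferences A. (a, b) \<in> s}. frequency \<pi> s)"
proof -
  have "\<pi> ! i \<in> preferences A" if "i < length \<pi>" for i
    using assms(2) that by (auto simp: profiles_def)
  then have "{i. i < length \<pi> \<and> (a, b) \<in> \<pi> ! i}
      = (\<Union>s \<in> {s \<in> preferences A. (a, b) \<in> s}. {i. i < length \<pi> \<and> \<pi> ! i = s})"
    by auto
  then show ?thesis
    unfolding frequency_def
    by (simp only:) (rule card_UN_disjoint, use finite_preferences[OF assms(1)] in auto)
qed

lemma flexible_consensus_majority:
  assumes A: "finite A" and \<pi>: "\<pi> \<in> profiles A n" and r: "r \<in> preferences A"
    and fc: "flexible_consensus A \<pi> r" and ab: "(a, b) \<in> r"
  shows "majority \<pi> a b"
proof -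
  have mem: "a \<in> A" "b \<in> A" using ab preferencesD(1)[OF r] by auto
  have "bij_betw (exchange a b) {s \<in> preferences A. (a, b) \<in> s} {s \<in> preferences A. (b, a) \<in> s}"
    by (rule bij_betw_byWitness[where f' = "exchange a b"])
      (auto simp: exchange_iff intro: exchange_in_preferences mem)
  then have "(\<Sum>s \<in> {s \<in> preferences A. (b, a) \<in> s}. frequency \<pi> s)
      = (\<Sum>s \<in> {s \<in> preferences A. (a, b) \<in> s}. frequency \<pi> (exchange a b s))"
    by (rule sum.reindex_bij_betw[symmetric])
  also have "\<dots> \<le> (\<Sum>s \<in> {s \<in> preferences A. (a, b) \<in> s}. frequency \<pi> s)"
  proof (rule sum_mono)
    fix s assume "s \<in> {s \<in> preferences A. (a, b) \<in> s}"
    then have s: "s \<in> preferences A" "(a, b) \<in> s" by auto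
    \<comment> \<open>If the exchanged order were more frequent, Flexible Consensus would place it
      no farther from \<open>r\<close> than \<open>s\<close>, against the strict increase of the
      distance.\<close>
    show "frequency \<pi> (exchange a b s) \<le> frequency \<pi> s"
      using fc s(1) exchange_in_preferences[OF s(1) mem]
        inversion_distance_exchange[OF A s(1) r s(2) ab]
      unfolding flexible_consensus_def by (meson not_le)
  qed
  finally show ?thesis
    by (simp add: majority_def card_voters_eq_sum_frequency[OF A \<pi>])
qed

text \<open>Each voter ranks the pair in exactly one way, so a tie would make \<open>n\<close> twice
  the common count.\<close>

lemma majority_antisym_odd:
  assumes \<pi>: "\<pi> \<in> profiles A n" and "odd n" and ab: "a \<in> A" "b \<in> A" "a \<noteq> b"
    and "majority \<pi> a b"
  shows "\<not> majority \<pi> b a"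
proof
  assume "majority \<pi> b a"
  with assms have eq: "card {i. i < length \<pi> \<and> (a, b) \<in> \<pi> ! i}
      = card {i. i < length \<pi> \<and> (b, a) \<in> \<pi> ! i}" (is "card ?X = card ?Y")
    by (simp add: majority_def)
  have pref: "\<pi> ! i \<in> preferences A" if "i < length \<pi>" for i
    using \<pi> that by (auto simp: profiles_def)
  have "{..<n} = ?X \<union> ?Y"
    using \<pi> preference_not_iff[OF pref ab] by (auto simp: profiles_def)
  moreover have "?X \<inter> ?Y = {}"
    using preference_asym[OF pref] by blast
  ultimately have "n = card ?X + card ?Y"
    by (metis (no_types, lifting) card_Un_disjoint card_lessThan finite_Un finite_lessThan)
  with eq \<open>odd n\<close> show False by simp
qed

text \<open>If \<open>r\<close> ranked \<open>b\<close> above \<open>a\<close>, the majority for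
  \<open>b\<close> over \<open>a\<close> would hold as well, and an odd \<open>n\<close> rules out
  majorities in both directions.\<close>

lemma flexible_consensus_iff_majority:
  assumes "finite A" and "\<pi> \<in> profiles A n" and "r \<in> preferences A"
    and "flexible_consensus A \<pi> r" and "odd n" and "a \<in> A" "b \<in> A" "a \<noteq> b"
  shows "(a, b) \<in> r \<longleftrightarrow> majority \<pi> a b"
  using flexible_consensus_majority[OF assms(1-4)] majority_antisym_odd[OF assms(2,5,6-8)]
    preference_not_iff[OF assms(3,6-8)] by blast

lemma best_first:
  assumes "finite A" "A \<noteq> {}" and r: "r \<in> preferences A"
  shows "best A r \<in> A \<and> (\<forall>b \<in> A. b \<noteq> best A r \<longrightarrow> (best A r, b) \<in> r)"
proof -
  have "finite r" using preferencesD(1)[OF r] assms(1) by (auto intro: finite_subset)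
  moreover have "acyclic r"
    using preferencesD(2,3)[OF r] by (simp add: acyclic_irrefl trancl_id)
  \<comment> \<open>The better alternative is the first component of a pair in \<open>r\<close>, so
    a minimal element of \<open>A\<close> is one that nothing beats.\<close>
  ultimately have "wf r" by (rule finite_acyclic_wf)
  then obtain a where a: "a \<in> A" "\<And>b. (b, a) \<in> r \<Longrightarrow> b \<notin> A"
    using assms(2) by (metis all_not_in_conv wf_eq_minimal)
  show ?thesis
    unfolding best_def
  proof (rule theI[where a = a])
    show first: "a \<in> A \<and> (\<forall>b \<in> A. b \<noteq> a \<longrightarrow> (a, b) \<in> r)"
      using a preference_not_iff[OF r] by blast
    fix x assume "x \<in> A \<and> (\<forall>b \<in> A. b \<noteq> x \<longrightarrow> (x, b) \<in> r)"
    then show "x = a" using first a(2)[of x] by metis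
  qed
qed

theorem theorem2:
  fixes A :: "'a set" and n :: nat and \<pi> :: "'a rel list" and r0 :: "'a rel"
  assumes "finite A" and "card A \<ge> 3"
    and "\<pi> \<in> profiles A n"
    and "r0 \<in> preferences A"
    and "flexible_consensus A \<pi> r0"
  shows "weak_condorcet_winner A \<pi> (best A r0) \<and>
    (odd n \<longrightarrow>
      (\<forall>a \<in> A. \<forall>b \<in> A. a \<noteq> b \<longrightarrow> ((a, b) \<in> r0 \<longleftrightarrow> majority \<pi> a b)) \<and>
      (\<forall>r \<in> preferences A. flexible_consensus A \<pi> r \<longrightarrow> r = r0))"
proof (intro conjI impI ballI)
  have "A \<noteq> {}" using assms(2) by auto
  from best_first[OF assms(1) this assms(4)] show "weak_condorcet_winner A \<pi> (best A r0)"
    unfolding weak_condorcet_winner_def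
    by (auto intro: flexible_consensus_majority[OF assms(1,3-5)])
next
  fix a b assume "odd n" "a \<in> A" "b \<in> A" "a \<noteq> b"
  then show "(a, b) \<in> r0 \<longleftrightarrow> majority \<pi> a b"
    by (rule flexible_consensus_iff_majority[OF assms(1,3-5)])
next
  fix r assume n: "odd n" and r: "r \<in> preferences A" "flexible_consensus A \<pi> r"
  \<comment> \<open>Both preferences agree with the majority relation on distinct alternatives. All
    other pairs lie in neither, since preferences are irreflexive and contained in
    \<open>A \<times> A\<close>.\<close>
  have "(a, b) \<in> r \<longleftrightarrow> (a, b) \<in> r0" for a b
  proof (cases "a \<in> A \<and> b \<in> A \<and> a \<noteq> b")
    case True
    then show ?thesis
      using flexible_consensus_iff_majority[OF assms(1,3-5) n]
        flexible_consensus_iff_majority[OF assms(1,3) r n] by blast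
  next
    case False
    then show ?thesis
      using preferencesD(1,3)[OF r(1)] preferencesD(1,3)[OF assms(4)] by (auto dest: irreflD)
  qed
  then show "r = r0" by auto
qed

end
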